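(* Let $X$ be a Bernoulli random variable with variance $\sigma^2>0$. Then for every $q\geq 1$, $$\frac{1}{2\pi}\int_{-\pi}^{\pi}\left|\mathbb{E}e^{itX}\right|^q dt\ \leq\ \frac{1}{\sqrt{6\sigma^2q}}\int_0^{\sqrt{6\sigma^2q}}e^{-t^2/2}\,dt.$$
   Context: A Bernoulli random variable $X$ takes values in $\{0,1\}$ with $\mathbb{P}(X=1)=p=1-\mathbb{P}(X=0)$ for some $p\in[0,1]$; its variance is $\sigma^2=p(1-p)$. *)

theory Defs
  imports "HOL-Probability.Probability"
begin

(* "Takes values in {0,1}" is imposed almost surely, which includes the case where it
   holds at every point of the sample space. *)
definition bernoulli_rv :: "'a measure \<Rightarrow> real \<Rightarrow> ('a \<Rightarrow> real) \<Rightarrow> bool" where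
  "bernoulli_rv M p X \<longleftrightarrow>
     prob_space M \<and> X \<in> borel_measurable M \<and> 0 \<le> p \<and> p \<le> 1 \<and>
     (AE \<omega> in M. X \<omega> \<in> {0, 1}) \<and>
     measure M {\<omega> \<in> space M. X \<omega> = 1} = p \<and>
     measure M {\<omega> \<in> space M. X \<omega> = 0} = 1 - p"

end

theory Submission
  imports Defs
begin

text \<open>
  With \<open>a = 2\<sigma>\<^sup>2q\<close>, the bound \<open>1 - y \<le> exp (-y)\<close> gives
  \<open>\<bar>\<phi>(t)\<bar>\<^sup>q \<le> exp (-a sin\<^sup>2(t/2))\<close>, and after rescaling both integrals it remains to compare
  \<open>exp (-a Y)\<close> and \<open>exp (-a Z)\<close> in the mean over \<open>[0,1]\<close>, where
  \<open>Y(x) = sin\<^sup>2(\<pi>x/2)\<close> and \<open>Z(x) = 3x\<^sup>2/2\<close>. Both are increasing with mean \<open>1/2\<close>, and by concavity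
  of the sine they cross exactly once, from \<open>Y > Z\<close> to \<open>Y < Z\<close>. Hence \<open>Y\<close> is below \<open>Z\<close> in the
  convex order, which is made explicit by a tangent inequality with the slope taken at the
  crossing point.
\<close>

section \<open>Concavity of the sine and its crossing with a line\<close>

lemma sin_mult_ge:
  fixes s y :: real
  assumes "0 \<le> s" "s \<le> 1" "0 \<le> y" "y \<le> pi"
  shows "s * sin y \<le> sin (s * y)"
proof -
  have "concave_on {0..pi} (sin :: real \<Rightarrow> real)"
    by (rule f''_le0_imp_concave[where f' = cos and f'' = "\<lambda>x. - sin x"])
       (auto intro!: derivative_eq_intros sin_ge_zero)
  from concave_onD[OF this assms(1,2), of 0 y] assms(3,4) show ?thesis
    by simp
qed

text \<open>Concavity together with \<open>sin 0 = 0\<close> makes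
  \<open>sin (pi / 2 * x) / x\<close> decreasing, so the graph stays above the chord through the
  origin before the meeting point and below it afterwards.\<close>

lemma sin_crosses_line:
  fixes \<beta> :: real
  assumes "1 \<le> \<beta>" "\<beta> \<le> sqrt 2"
  obtains c where "0 \<le> c" "c \<le> 1"
    and "\<And>x. 0 \<le> x \<Longrightarrow> x \<le> c \<Longrightarrow> \<beta> * x \<le> sin (pi / 2 * x)"
    and "\<And>x. c \<le> x \<Longrightarrow> x \<le> 1 \<Longrightarrow> sin (pi / 2 * x) \<le> \<beta> * x"
proof -
  \<comment> \<open>Starting at 1/2 avoids the trivial root 0 and makes \<open>c\<close> a valid
    divisor. The sign at 1/2 comes from \<beta> \<le> \<open>sqrt 2\<close>, the sign at 1 from 1
    \<le> \<beta>.\<close>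
  have "\<exists>c. 1 / 2 \<le> c \<and> c \<le> 1 \<and> sin (pi / 2 * c) - \<beta> * c = 0"
  proof (rule IVT2')
    show "0 \<le> sin (pi / 2 * (1 / 2)) - \<beta> * (1 / 2)"
      using assms by (simp add: sin_45)
  qed (use assms in \<open>auto intro!: continuous_intros\<close>)
  then obtain c where c: "1 / 2 \<le> c" "c \<le> 1" and eq: "sin (pi / 2 * c) = \<beta> * c"
    by auto
  show thesis
  proof
    show "0 \<le> c" "c \<le> 1" using c by auto
  next
    fix x :: real assume "0 \<le> x" "x \<le> c"
    with c have "x / c * sin (pi / 2 * c) \<le> sin (x / c * (pi / 2 * c))"
      by (intro sin_mult_ge) (auto simp: mult_le_cancel_left1)
    also have "x / c * (pi / 2 * c) = pi / 2 * x"
      using c by simp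
    finally show "\<beta> * x \<le> sin (pi / 2 * x)"
      using c unfolding eq by (simp add: mult.commute)
  next
    fix x :: real assume x: "c \<le> x" "x \<le> 1"
    \<comment> \<open>The roles are exchanged: beyond the crossing, \<open>c\<close> is the
      contraction of \<open>x\<close>.\<close>
    with c have "c / x * sin (pi / 2 * x) \<le> sin (c / x * (pi / 2 * x))"
      by (intro sin_mult_ge) (auto simp: mult_le_cancel_left1)
    also have "c / x * (pi / 2 * x) = pi / 2 * c"
      using x c by simp
    finally have "c * sin (pi / 2 * x) \<le> c * (\<beta> * x)"
      using x c unfolding eq by (simp add: field_simps)
    with c show "sin (pi / 2 * x) \<le> \<beta> * x"
      by (subst (asm) mult_le_cancel_left_pos) auto
  qed
qed

section \<open>Comparison of the two exponential means over the unit interval\<close>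

text \<open>The tangent at \<open>y\<close> to the convex function \<open>exp (- a * _)\<close> lies
  below it. Moving its slope from \<open>y\<close> to \<open>h\<close> only lowers the left side,
  because \<open>z - y\<close> has the same sign as \<open>y - h\<close> up to equality. With
  \<open>h\<close> fixed, the coefficient of \<open>z - y\<close> is constant and can be integrated
  out.\<close>

lemma exp_tangent_ge:
  fixes a h y z :: real
  assumes "0 \<le> a" "z \<le> y \<and> y \<le> h \<or> h \<le> y \<and> y \<le> z"
  shows "exp (- a * y) - a * exp (- a * h) * (z - y) \<le> exp (- a * z)"
proof -
  have "1 - a * (z - y) \<le> exp (- a * (z - y))"
    using exp_ge_add_one_self[of "- a * (z - y)"] by simp
  then have "exp (- a * y) * (1 - a * (z - y)) \<le> exp (- a * y) * exp (- a * (z - y))"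
    by (rule mult_left_mono) simp
  also have "\<dots> = exp (- a * z)"
    by (simp add: algebra_simps flip: exp_add)
  finally have tangent: "exp (- a * y) - a * exp (- a * y) * (z - y) \<le> exp (- a * z)"
    by (simp add: algebra_simps)
  have "exp (- a * y) * (z - y) \<le> exp (- a * h) * (z - y)"
    using assms(2)
  proof
    assume "z \<le> y \<and> y \<le> h"
    with \<open>0 \<le> a\<close> show ?thesis
      by (intro mult_right_mono_neg) (auto intro: mult_left_mono)
  next
    assume "h \<le> y \<and> y \<le> z"
    with \<open>0 \<le> a\<close> show ?thesis
      by (intro mult_right_mono) (auto intro: mult_left_mono)
  qed
  from mult_left_mono[OF this \<open>0 \<le> a\<close>] tangent show ?thesis
    by (simp add: algebra_simps)
qed

lemma has_integral_sin_squared_half: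
  "((\<lambda>x. (sin (pi / 2 * x))\<^sup>2) has_integral 1 / 2) {0..1}"
proof -
  have "((\<lambda>x. x / 2 - sin (pi * x) / (2 * pi)) has_vector_derivative (sin (pi / 2 * x))\<^sup>2)
      (at x within {0..1})" for x
  proof -
    have "(sin (pi / 2 * x))\<^sup>2 = 1 / 2 - cos (pi * x) / 2"
      using cos_double_sin[of "pi / 2 * x"] by (simp add: field_simps)
    then show ?thesis
      by (auto intro!: derivative_eq_intros simp flip: has_real_derivative_iff_has_vector_derivative)
  qed
  from fundamental_theorem_of_calculus[OF _ this] show ?thesis
    by simp
qed

text \<open>The factor 3/2 is chosen to match the mean of the squared sine; it is the origin of the
  6 in the final bound.\<close>

lemma has_integral_square: "((\<lambda>x::real. 3 / 2 * x\<^sup>2) has_integral 1 / 2) {0..1}"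
proof -
  have "((\<lambda>x::real. x ^ 3 / 2) has_vector_derivative 3 / 2 * x\<^sup>2) (at x within {0..1})" for x
    by (auto intro!: derivative_eq_intros simp flip: has_real_derivative_iff_has_vector_derivative)
  from fundamental_theorem_of_calculus[OF _ this] show ?thesis
    by simp
qed

lemma integral_exp_sin_squared_le:
  fixes a :: real
  assumes "0 \<le> a"
  shows "integral {0..1} (\<lambda>x. exp (- a * (sin (pi / 2 * x))\<^sup>2))
    \<le> integral {0..1} (\<lambda>x. exp (- a * (3 / 2 * x\<^sup>2)))"
proof -
  define Y Z :: "real \<Rightarrow> real" where "Y = (\<lambda>x. (sin (pi / 2 * x))\<^sup>2)" and "Z = (\<lambda>x. 3 / 2 * x\<^sup>2)"
  \<comment> \<open>The slope is \<open>sqrt (3 / 2)\<close> because \<open>Z\<close> is the square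
    of that line, so crossing of the unsquared functions decides the order of \<open>Y\<close> and
    \<open>Z\<close>.\<close>
  have "1 \<le> sqrt (3 / 2)" "sqrt (3 / 2) \<le> sqrt 2"
    by auto
  then obtain c where c: "0 \<le> c" "c \<le> 1"
    and below: "\<And>x. 0 \<le> x \<Longrightarrow> x \<le> c \<Longrightarrow> sqrt (3 / 2) * x \<le> sin (pi / 2 * x)"
    and above: "\<And>x. c \<le> x \<Longrightarrow> x \<le> 1 \<Longrightarrow> sin (pi / 2 * x) \<le> sqrt (3 / 2) * x"
    using sin_crosses_line by blast
  have Z_eq: "Z x = (sqrt (3 / 2) * x)\<^sup>2" for x
    by (simp add: Z_def power_mult_distrib)
  have Y_mono: "Y x \<le> Y y" if "0 \<le> x" "x \<le> y" "y \<le> 1" for x y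
    unfolding Y_def using that
    by (intro power_mono sin_monotone_2pi_le sin_ge_zero) (auto simp: field_simps intro: order_trans[of _ 0])
  have ptw: "exp (- a * Y x) - a * exp (- a * Y c) * (Z x - Y x) \<le> exp (- a * Z x)"
    if x: "x \<in> {0..1}" for x
  proof (rule exp_tangent_ge[OF assms])
    show "Z x \<le> Y x \<and> Y x \<le> Y c \<or> Y c \<le> Y x \<and> Y x \<le> Z x"
    proof (cases "x \<le> c")
      case True
      with x below[of x] c have "Z x \<le> Y x"
        unfolding Z_eq by (auto simp: Y_def intro!: power_mono)
      with True x c show ?thesis by (auto intro: Y_mono)
    next
      case False
      \<comment> \<open>Nonnegativity of the sine lets the inequality from \<open>above\<close> be
        squared.\<close>
      have "0 \<le> sin (pi / 2 * x)"
        using x by (intro sin_ge_zero) (auto simp: field_simps mult_le_cancel_left1)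
      with False x above[of x] have "Y x \<le> Z x"
        unfolding Z_eq by (auto simp: Y_def intro!: power_mono)
      with False x c show ?thesis by (auto intro: Y_mono)
    qed
  qed
  have int: "(Y has_integral 1 / 2) {0..1}" "(Z has_integral 1 / 2) {0..1}"
    unfolding Y_def Z_def by (rule has_integral_sin_squared_half has_integral_square)+
  have exp_int: "(\<lambda>x. exp (- a * Y x)) integrable_on {0..1}" "(\<lambda>x. exp (- a * Z x)) integrable_on {0..1}"
    unfolding Y_def Z_def by (intro integrable_continuous_real continuous_intros)+
  \<comment> \<open>The equal means of \<open>Y\<close> and \<open>Z\<close> cancel the linear
    term.\<close>
  have "((\<lambda>x. exp (- a * Y x) - a * exp (- a * Y c) * (Z x - Y x)) has_integral
      integral {0..1} (\<lambda>x. exp (- a * Y x)) - a * exp (- a * Y c) * (1 / 2 - 1 / 2)) {0..1}"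
    by (intro has_integral_diff has_integral_mult_right int integrable_integral exp_int)
  from has_integral_le[OF this integrable_integral[OF exp_int(2)] ptw] show ?thesis
    by (simp add: Y_def Z_def)
qed

section \<open>Conversion, symmetry and rescaling of integrals\<close>

lemma interval_integral_continuous:
  fixes f :: "real \<Rightarrow> real"
  assumes "a \<le> b" "continuous_on {a..b} f"
  shows "(LBINT x=ereal a..ereal b. f x) = integral {a..b} f"
  using assms borel_integrable_atLeastAtMost'[of a b f]
  by (intro interval_integral_eq_integral) auto

lemma integral_even_symmetric:
  fixes f :: "real \<Rightarrow> real"
  assumes "0 \<le> b" "continuous_on {-b..b} f" "\<And>x. f (- x) = f x"
  shows "integral {-b..b} f = 2 * integral {0..b} f"
proof -
  have "integral {-b..b} f = integral {-b..0} f + integral {0..b} f"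
    using assms by (intro Henstock_Kurzweil_Integration.integral_combine[symmetric] integrable_continuous_real) auto
  also have "integral {-b..0} f = integral {0..b} f"
    using Henstock_Kurzweil_Integration.integral_reflect_real[of b 0 f] assms(3) by simp
  finally show ?thesis by simp
qed

lemma integral_dilation:
  fixes f :: "real \<Rightarrow> real"
  assumes "0 < m"
  shows "integral {0..m} f = m * integral {0..1} (\<lambda>x. f (m * x))"
  using assms integral_stretch_real[of m 0 m f] by simp

section \<open>Moments and characteristic function of a Bernoulli variable\<close>

context
  fixes M :: "'a measure" and p :: real and X :: "'a \<Rightarrow> real"
  assumes X: "bernoulli_rv M p X"
begin

interpretation prob_space M
  using X by (simp add: bernoulli_rv_def)

lemma bernoulli_measurable [measurable]: "X \<in> borel_measurable M"
  and bernoulli_AE: "AE \<omega> in M. X \<omega> \<in> {0, 1}"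
  using X by (simp_all add: bernoulli_rv_def)

text \<open>Almost surely \<open>X\<close> is the indicator of the event
  \<open>X = 1\<close>.\<close>

lemma bernoulli_expectation:
  shows "integrable M X" and "expectation X = p"
proof -
  let ?I = "indicator {\<omega> \<in> space M. X \<omega> = 1} :: 'a \<Rightarrow> real"
  have AE: "AE \<omega> in M. ?I \<omega> = X \<omega>"
    using bernoulli_AE AE_space by eventually_elim auto
  have "integrable M ?I"
    by (intro integrable_real_indicator) (auto simp: emeasure_eq_measure)
  from integrable_cong_AE_imp[OF this bernoulli_measurable AE] show "integrable M X" .
  have "expectation ?I = expectation X"
    by (intro integral_cong_AE AE) measurable
  moreover have "prob {\<omega> \<in> space M. X \<omega> = 1} = p"
    using X by (simp add: bernoulli_rv_def)
  ultimately show "expectation X = p" by simp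
qed

text \<open>On the values 0 and 1 the square of \<open>X\<close> is \<open>X\<close>, so the squared
  deviation is affine in \<open>X\<close>.\<close>

lemma bernoulli_variance: "variance X = p * (1 - p)"
proof -
  have "AE \<omega> in M. (X \<omega> - p)\<^sup>2 = p\<^sup>2 + (1 - 2 * p) * X \<omega>"
    using bernoulli_AE by eventually_elim (auto simp: power2_eq_square algebra_simps)
  then have "variance X = expectation (\<lambda>\<omega>. p\<^sup>2 + (1 - 2 * p) * X \<omega>)"
    unfolding bernoulli_expectation by (intro integral_cong_AE) measurable
  also have "\<dots> = p * (1 - p)"
    using bernoulli_expectation by (simp add: prob_space power2_eq_square algebra_simps)
  finally show ?thesis .
qed

text \<open>Every function on {0,1} is affine, so the expectation of the exponential reduces to that
  of \<open>X\<close>.\<close>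

lemma bernoulli_char:
  "(LINT \<omega>|M. exp (\<i> * complex_of_real (t * X \<omega>))) = 1 - complex_of_real p + p * cis t"
proof -
  have "AE \<omega> in M. exp (\<i> * complex_of_real (t * X \<omega>)) = 1 + (cis t - 1) * complex_of_real (X \<omega>)"
    using bernoulli_AE by eventually_elim (auto simp: cis_conv_exp)
  then have "(LINT \<omega>|M. exp (\<i> * complex_of_real (t * X \<omega>)))
      = (LINT \<omega>|M. 1 + (cis t - 1) * complex_of_real (X \<omega>))"
    by (intro integral_cong_AE) measurable
  also have "\<dots> = 1 + (cis t - 1) * complex_of_real p"
    using bernoulli_expectation by (simp add: prob_space)
  finally show ?thesis
    by (simp add: algebra_simps)
qed

end

lemma cmod_bernoulli_char:
  "(cmod (1 - complex_of_real p + p * cis t))\<^sup>2 = 1 - 4 * (p * (1 - p)) * (sin (t / 2))\<^sup>2"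
proof -
  have "(cmod (1 - complex_of_real p + p * cis t))\<^sup>2 = (1 - p + p * cos t)\<^sup>2 + (p * sin t)\<^sup>2"
    by (simp add: cmod_power2)
  also have "\<dots> = (1 - p)\<^sup>2 + 2 * p * (1 - p) * cos t + p\<^sup>2 * ((sin t)\<^sup>2 + (cos t)\<^sup>2)"
    unfolding power2_eq_square by algebra
  also have "\<dots> = 1 - 2 * p * (1 - p) * (1 - cos t)"
    by (simp add: power2_eq_square algebra_simps)
  also have "cos t = 1 - 2 * (sin (t / 2))\<^sup>2"
    using cos_double_sin[of "t / 2"] by simp
  finally show ?thesis by simp
qed

lemma cmod_bernoulli_char_powr_le:
  assumes "0 \<le> q"
  shows "cmod (1 - complex_of_real p + p * cis t) powr q
    \<le> exp (- (2 * (p * (1 - p)) * q) * (sin (t / 2))\<^sup>2)"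
proof -
  \<comment> \<open>The squared modulus is \<open>1 - 2 * ?s\<close>, so the bound
    \<open>exp (- (2 * ?s))\<close> is the square of \<open>exp (- ?s)\<close>.\<close>
  let ?s = "2 * (p * (1 - p)) * (sin (t / 2))\<^sup>2"
  have "(cmod (1 - complex_of_real p + p * cis t))\<^sup>2 \<le> (exp (- ?s))\<^sup>2"
    using exp_ge_add_one_self[of "- (2 * ?s)"] by (simp add: cmod_bernoulli_char flip: exp_double)
  then have "cmod (1 - complex_of_real p + p * cis t) \<le> exp (- ?s)"
    by (rule power2_le_imp_le) simp
  then have "cmod (1 - complex_of_real p + p * cis t) powr q \<le> exp (- ?s) powr q"
    using assms by (intro powr_mono2) auto
  then show ?thesis
    by (simp add: exp_powr_real algebra_simps)
qed

section \<open>Domination of the characteristic function and rescaling to the unit interval\<close>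

theorem theorem2p3:
  fixes M :: "'a measure" and X :: "'a \<Rightarrow> real" and p \<sigma> q :: real
  assumes "bernoulli_rv M p X"
    and "prob_space.variance M X = \<sigma>\<^sup>2"
    and "\<sigma>\<^sup>2 > 0"
    and "q \<ge> 1"
  shows "1 / (2 * pi) * (LBINT t=-pi..pi. cmod (LINT \<omega>|M. exp (\<i> * complex_of_real (t * X \<omega>))) powr q)
    \<le> 1 / sqrt (6 * \<sigma>\<^sup>2 * q) * (LBINT t=0..sqrt (6 * \<sigma>\<^sup>2 * q). exp (- (t\<^sup>2 / 2)))"
proof -
  define a r where "a = 2 * \<sigma>\<^sup>2 * q" and "r = sqrt (6 * \<sigma>\<^sup>2 * q)"
  have "0 < a" "0 < r"
    using assms by (auto simp: a_def r_def)
  have r2: "r\<^sup>2 = 3 * a"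
    using assms by (simp add: a_def r_def)
  have var: "\<sigma>\<^sup>2 = p * (1 - p)"
    using bernoulli_variance[OF assms(1)] assms(2) by simp
  define g where "g = (\<lambda>t::real. exp (- a * (sin (t / 2))\<^sup>2))"
  have cont: "continuous_on S g" for S
    unfolding g_def by (intro continuous_intros) auto
  have "(LBINT t=-pi..pi. cmod (LINT \<omega>|M. exp (\<i> * complex_of_real (t * X \<omega>))) powr q)
      \<le> (LBINT t=-pi..pi. g t)"
  proof -
    have "(LINT t:{-pi..pi}|lborel. cmod (LINT \<omega>|M. exp (\<i> * complex_of_real (t * X \<omega>))) powr q)
        \<le> (LINT t:{-pi..pi}|lborel. g t)"
      unfolding set_lebesgue_integral_def
    \<comment> \<open>This form of monotonicity asks for integrability of the nonnegative majorant
      only: a non-integrable left side would have integral 0 by convention.\<close>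
    proof (rule integral_mono')
      show "integrable lborel (\<lambda>t. indicator {-pi..pi} t *\<^sub>R g t)"
        using borel_integrable_atLeastAtMost'[OF cont] by (simp add: set_integrable_def)
    next
      fix t
      show "indicator {-pi..pi} t *\<^sub>R (cmod (LINT \<omega>|M. exp (\<i> * complex_of_real (t * X \<omega>))) powr q)
          \<le> indicator {-pi..pi} t *\<^sub>R g t"
        using cmod_bernoulli_char_powr_le[of q p t] assms(4)
        unfolding bernoulli_char[OF assms(1)] g_def a_def var
        by (intro scaleR_left_mono) auto
    qed (simp add: g_def)
    then show ?thesis
      by (subst (1 2) interval_integral_Icc) (simp_all del: of_real_mult)
  qed
  also have "\<dots> = integral {-pi..pi} g"
    by (rule interval_integral_continuous[OF _ cont]) simp
  also have "\<dots> = 2 * (pi * integral {0..1} (\<lambda>x. g (pi * x)))"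
    using integral_even_symmetric[of pi g] integral_dilation[of pi g] cont by (simp add: g_def)
  finally have "1 / (2 * pi) * (LBINT t=-pi..pi. cmod (LINT \<omega>|M. exp (\<i> * complex_of_real (t * X \<omega>))) powr q)
      \<le> 1 / (2 * pi) * (2 * (pi * integral {0..1} (\<lambda>x. g (pi * x))))"
    by (rule mult_left_mono) simp
  also have "\<dots> = integral {0..1} (\<lambda>x. g (pi * x))"
    by simp
  \<comment> \<open>Since \<open>r\<^sup>2 = 3 * a\<close>, the exponent
    \<open>a * (3 / 2 * x\<^sup>2)\<close> equals \<open>(r * x)\<^sup>2 / 2\<close>.\<close>
  also have "\<dots> \<le> integral {0..1} (\<lambda>x. exp (- ((r * x)\<^sup>2 / 2)))"
    using integral_exp_sin_squared_le[of a] \<open>0 < a\<close>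
    by (simp add: g_def power_mult_distrib r2 mult_ac)
  also have "\<dots> = 1 / r * integral {0..r} (\<lambda>t. exp (- (t\<^sup>2 / 2)))"
    using integral_dilation[OF \<open>0 < r\<close>, of "\<lambda>t. exp (- (t\<^sup>2 / 2))"] \<open>0 < r\<close> by simp
  also have "\<dots> = 1 / r * (LBINT t=0..r. exp (- (t\<^sup>2 / 2)))"
    using \<open>0 < r\<close> unfolding zero_ereal_def
    by (subst interval_integral_continuous) (auto intro!: continuous_intros)
  finally show ?thesis
    unfolding r_def .
qed

end
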